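(* Let $\mu>-\tfrac12$ and let $w_\mu(x)=|x|^{2\mu}e^{-x^2}$, $x\in\mathbb{R}$, be the generalised Hermite weight. Then $w_\mu$ is neither separable nor symmetrically separable.
   Context: Let $\{p_n\}_{n\in\mathbb{Z}_+}$, $\mathbb{Z}_+=\{0,1,2,\dots\}$, be the orthonormal polynomials with respect to $w_\mu$ on $\mathbb{R}$, $\varphi_n=\sqrt{w_\mu}\,p_n$, and $\mathcal{D}_{m,n}=\int_{-\infty}^\infty\varphi_m'(x)\varphi_n(x)\,dx$ the differentiation matrix (by symmetry $\mathcal{D}_{m,n}=0$ for $m+n$ even, if necessary in the principal value sense). A weight is separable if there exist real sequences $\{\mathfrak{a}_n\}_{n\in\mathbb{Z}_+},\{\mathfrak{b}_n\}_{n\in\mathbb{Z}_+}$ such that $\mathcal{D}_{m,n}=\mathfrak{a}_m\mathfrak{b}_n$ for $m\ge n+1$, $\mathcal{D}_{m,m}=0$, and $\mathcal{D}_{m,n}=-\mathfrak{a}_n\mathfrak{b}_m$ for $m\le n-1$. It is symmetrically separable if there exist real sequences such that $\mathcal{D}_{m,n}=0$ for $m+n$ even and, for $m+n$ odd, $\mathcal{D}_{m,n}=-\mathfrak{a}_m\mathfrak{b}_n$ if $m\ge n+1$ and $\mathcal{D}_{m,n}=\mathfrak{a}_n\mathfrak{b}_m$ if $m\le n-1$. *)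

theory Defs
  imports "HOL-Analysis.Analysis" "HOL-Computational_Algebra.Polynomial"
begin

text \<open>
  Real powers satisfy \<open>0 powr a = 0\<close> for every \<open>a\<close>, so the case \<open>\<mu> = 0\<close> (the classical Hermite
  weight) is split off to have \<open>\<bar>0\<bar> ^ 0 = 1\<close>. For \<open>\<mu> < 0\<close> the weight is singular at the origin and
  gets the conventional value \<open>0\<close> there.
\<close>

definition gen_hermite_weight :: "real \<Rightarrow> real \<Rightarrow> real" where
  "gen_hermite_weight \<mu> x = (if \<mu> = 0 then 1 else \<bar>x\<bar> powr (2 * \<mu>)) * exp (- (x ^ 2))"

text \<open>
  The positive leading coefficient is the usual normalisation that makes the system unique.
  Integrability is explicit because the Bochner integral of a non-integrable function is \<open>0\<close>.
\<close>

definition orthonormal_poly_seq :: "(real \<Rightarrow> real) \<Rightarrow> (nat \<Rightarrow> real poly) \<Rightarrow> bool" where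
  "orthonormal_poly_seq w p \<longleftrightarrow>
     (\<forall>n. degree (p n) = n \<and> lead_coeff (p n) > 0) \<and>
     (\<forall>m n. integrable lborel (\<lambda>x. w x * poly (p m) x * poly (p n) x) \<and>
            (LINT x|lborel. w x * poly (p m) x * poly (p n) x) = (if m = n then 1 else 0))"

definition orthonormal_poly :: "(real \<Rightarrow> real) \<Rightarrow> nat \<Rightarrow> real poly" where
  "orthonormal_poly w = (THE p. orthonormal_poly_seq w p)"

definition phi :: "(real \<Rightarrow> real) \<Rightarrow> nat \<Rightarrow> real \<Rightarrow> real" where
  "phi w n x = sqrt (w x) * poly (orthonormal_poly w n) x"

text \<open>
  The principal value is taken at the origin, the only singularity of the generalised Hermite
  weight, and only when the integral does not converge absolutely.
\<close>

definition pv_integral :: "(real \<Rightarrow> real) \<Rightarrow> real" where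
  "pv_integral f =
     (if integrable lborel f then LINT x|lborel. f x
      else Lim (at_right 0) (\<lambda>\<epsilon>. LINT x:{x. \<epsilon> < \<bar>x\<bar>}|lborel. f x))"

definition diff_matrix :: "(real \<Rightarrow> real) \<Rightarrow> nat \<Rightarrow> nat \<Rightarrow> real" where
  "diff_matrix w m n = pv_integral (\<lambda>x. deriv (phi w m) x * phi w n x)"

definition separable :: "(real \<Rightarrow> real) \<Rightarrow> bool" where
  "separable w \<longleftrightarrow>
     (\<exists>a b :: nat \<Rightarrow> real. \<forall>m n.
        (m \<ge> n + 1 \<longrightarrow> diff_matrix w m n = a m * b n) \<and>
        (m = n \<longrightarrow> diff_matrix w m n = 0) \<and>
        (m + 1 \<le> n \<longrightarrow> diff_matrix w m n = - (a n * b m)))"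

definition symmetrically_separable :: "(real \<Rightarrow> real) \<Rightarrow> bool" where
  "symmetrically_separable w \<longleftrightarrow>
     (\<exists>a b :: nat \<Rightarrow> real. \<forall>m n.
        (even (m + n) \<longrightarrow> diff_matrix w m n = 0) \<and>
        (odd (m + n) \<and> m \<ge> n + 1 \<longrightarrow> diff_matrix w m n = - (a m * b n)) \<and>
        (odd (m + n) \<and> m + 1 \<le> n \<longrightarrow> diff_matrix w m n = a n * b m))"

end

theory Submission
  imports Defs
begin

text \<open>
  The rows of odd index of the differentiation matrix are, above the diagonal, those of a
  tridiagonal matrix, and this is incompatible with both kinds of separability.

  Let \<open>m\<close> be odd and \<open>m < n\<close>. Since the weight is even, \<open>p\<^sub>m\<close> is an odd polynomial, so
  \<open>p\<^sub>m(0) = 0\<close> and \<open>r = p\<^sub>m / x\<close> is a polynomial. Because \<open>(\<surd>w)' = \<surd>w (\<mu>/x - x)\<close>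
  away from the origin,
  \<open>\<phi>\<^sub>m' \<phi>\<^sub>n = w (p\<^sub>m' + \<mu> r - x p\<^sub>m) p\<^sub>n\<close>: the singular term \<open>\<mu>/x\<close> has become polynomial,
  and the integrals converge absolutely. Now \<open>p\<^sub>m'\<close> and \<open>r\<close> have degree less than \<open>n\<close>, so
  orthogonality leaves only the integral of \<open>- w x p\<^sub>m p\<^sub>n\<close>. As \<open>x p\<^sub>m\<close> has degree \<open>m + 1\<close>,
  this vanishes for \<open>n > m + 1\<close>, and for \<open>n = m + 1\<close> it is minus a quotient of positive
  leading coefficients (lemma \<open>diff_matrix_gen_hermite_weight_odd_row\<close>).

  Hence the entries (1,2) and (3,4) are nonzero while the entry (1,4) is zero. In either
  notion of separability these entries are, up to a common sign, \<open>a\<^sub>2 b\<^sub>1\<close>, \<open>a\<^sub>4 b\<^sub>3\<close>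
  and \<open>a\<^sub>4 b\<^sub>1\<close>, so that \<open>b\<^sub>1 \<noteq> 0\<close> and \<open>a\<^sub>4 \<noteq> 0\<close> although \<open>a\<^sub>4 b\<^sub>1 = 0\<close>.

  The polynomials \<open>p\<^sub>n\<close> are given by a definite description, so their existence and
  uniqueness have to be established first; uniqueness also yields their parity.
\<close>

section \<open>Orthonormal polynomials of a weight with finite moments\<close>

locale moment_weight =
  fixes w :: "real \<Rightarrow> real"
  assumes weight_pos: "AE x in lborel. 0 < w x"
    and moments: "\<And>n. integrable lborel (\<lambda>x. w x * x ^ n)"
begin

definition mom :: "real poly \<Rightarrow> real" where
  "mom q = (LINT x|lborel. w x * poly q x)"

lemma integrable_weight_poly: "integrable lborel (\<lambda>x. w x * poly q x)"
proof -
  have "(\<lambda>x. w x * poly q x) = (\<lambda>x. \<Sum>i\<le>degree q. coeff q i * (w x * x ^ i))"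
    by (auto simp: poly_altdef sum_distrib_left mult_ac)
  then show ?thesis
    using moments by simp
qed

lemma mom_add: "mom (p + q) = mom p + mom q"
  unfolding mom_def poly_add distrib_left
  by (rule Bochner_Integration.integral_add[OF integrable_weight_poly integrable_weight_poly])

lemma mom_diff: "mom (p - q) = mom p - mom q"
  unfolding mom_def poly_diff right_diff_distrib
  by (rule Bochner_Integration.integral_diff[OF integrable_weight_poly integrable_weight_poly])

lemma mom_smult: "mom (smult c q) = c * mom q"
  unfolding mom_def by (simp add: mult.left_commute)

lemmas mom_simps = mom_add mom_diff mom_smult left_diff_distrib right_diff_distrib distrib_left distrib_right

lemma mom_0 [simp]: "mom 0 = 0"
  by (simp add: mom_def)

text \<open>
  This is where positivity of the weight enters: a nonzero polynomial has only finitely many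
  roots, so \<open>q\<^sup>2\<close> is positive almost everywhere.
\<close>

lemma mom_square_pos:
  assumes "q \<noteq> 0"
  shows "0 < mom (q * q)"
proof -
  have nonneg: "AE x in lborel. 0 \<le> w x * poly (q * q) x"
    using weight_pos by eventually_elim simp
  have "finite {x. poly q x = 0}"
    using assms by (rule poly_roots_finite)
  then have "AE x in lborel. x \<notin> {x. poly q x = 0}"
    by (intro AE_not_in finite_imp_null_set_lborel)
  then have ne: "AE x in lborel. w x * poly (q * q) x \<noteq> 0"
    using weight_pos by eventually_elim simp
  have "mom (q * q) \<noteq> 0"
  proof
    assume "mom (q * q) = 0"
    then have "AE x in lborel. w x * poly (q * q) x = 0"
      using integral_nonneg_eq_0_iff_AE[OF integrable_weight_poly nonneg] by (simp add: mom_def)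
    then have "AE x in (lborel :: real measure). False"
      using ne by eventually_elim simp
    then show False
      using ae_filter_eq_bot_iff[of "lborel :: real measure"]
      by (simp add: trivial_limit_def)
  qed
  moreover have "0 \<le> mom (q * q)"
    unfolding mom_def using nonneg by (rule integral_nonneg_AE)
  ultimately show ?thesis
    by simp
qed

text \<open>
  Gram--Schmidt in the form of projections. The vanishing of all coefficients from index \<open>n\<close> on
  expresses being of degree less than \<open>n\<close> in a way that also covers the zero polynomial and
  \<open>n = 0\<close>. In the induction step the new direction is \<open>e\<close>, which is \<open>x\<^sup>n\<close> minus its own
  projection.
\<close>

lemma orthogonal_projection:
  "\<exists>q. (\<forall>i\<ge>n. coeff q i = 0) \<and> (\<forall>g. (\<forall>i\<ge>n. coeff g i = 0) \<longrightarrow> mom ((f - q) * g) = 0)"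
proof (induction n arbitrary: f)
  case 0
  show ?case
  proof (intro exI[of _ 0] conjI allI impI)
    fix g :: "real poly" assume "\<forall>i\<ge>0. coeff g i = 0"
    then have "g = 0"
      by (intro poly_eqI) simp
    then show "mom ((f - 0) * g) = 0"
      by simp
  qed simp
next
  case (Suc n)
  obtain q where q: "\<And>i. i \<ge> n \<Longrightarrow> coeff q i = 0"
    "\<And>g. (\<And>i. i \<ge> n \<Longrightarrow> coeff g i = 0) \<Longrightarrow> mom ((f - q) * g) = 0"
    using Suc.IH[of f] by blast
  obtain t where t: "\<And>i. i \<ge> n \<Longrightarrow> coeff t i = 0"
    "\<And>g. (\<And>i. i \<ge> n \<Longrightarrow> coeff g i = 0) \<Longrightarrow> mom ((monom 1 n - t) * g) = 0"
    using Suc.IH[of "monom 1 n"] by blast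
  define e where "e = monom 1 n - t"
  have e_n: "coeff e n = 1" and e_gt: "\<And>i. i > n \<Longrightarrow> coeff e i = 0"
    by (auto simp: e_def t)
  have "mom (e * e) > 0"
    using e_n by (intro mom_square_pos) auto
  define c where "c = mom (f * e) / mom (e * e)"
  have "mom (q * e) = 0"
    using t(2)[of q] q(1) by (simp add: e_def mult.commute)
  moreover have "mom ((f - (q + smult c e)) * e) = mom (f * e) - mom (q * e) - c * mom (e * e)"
    by (simp add: mom_simps)
  ultimately have fe: "mom ((f - (q + smult c e)) * e) = 0"
    using \<open>mom (e * e) > 0\<close> by (simp add: c_def)
  show ?case
  proof (intro exI[of _ "q + smult c e"] conjI allI impI)
    fix i assume "i \<ge> Suc n"
    then show "coeff (q + smult c e) i = 0"
      using q(1) e_gt by simp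
  next
    fix g :: "real poly" assume g: "\<forall>i\<ge>Suc n. coeff g i = 0"
    define h where "h = g - smult (coeff g n) e"
    have h: "coeff h i = 0" if "i \<ge> n" for i
      using that g e_n e_gt by (cases "i = n") (auto simp: h_def)
    have "mom ((f - q) * h) = 0" "mom (e * h) = 0"
      using q(2)[of h] t(2)[of h] h by (auto simp: e_def)
    then have "mom ((f - (q + smult c e)) * h) = 0"
      by (simp add: mom_simps)
    moreover have "mom ((f - (q + smult c e)) * g) =
        mom ((f - (q + smult c e)) * h) + coeff g n * mom ((f - (q + smult c e)) * e)"
      unfolding mom_smult[symmetric] mom_add[symmetric] mult_smult_right[symmetric]
        distrib_left[symmetric] by (simp add: h_def)
    ultimately show "mom ((f - (q + smult c e)) * g) = 0"
      using fe by simp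
  qed
qed

lemma orthonormal_poly_seq_iff:
  "orthonormal_poly_seq w p \<longleftrightarrow>
     (\<forall>n. degree (p n) = n \<and> coeff (p n) n > 0) \<and>
     (\<forall>m n. mom (p m * p n) = (if m = n then 1 else 0))"
proof -
  have "integrable lborel (\<lambda>x. w x * poly (p m) x * poly (p n) x)" for m n
    using integrable_weight_poly[of "p m * p n"] by (simp add: mult.assoc)
  then show ?thesis
    by (simp add: orthonormal_poly_seq_def mom_def mult.assoc cong: conj_cong)
qed

lemma ex_orthonormal_poly_seq: "\<exists>p. orthonormal_poly_seq w p"
proof -
  have "\<exists>p. degree p = n \<and> coeff p n > 0 \<and> mom (p * p) = 1 \<and>
          (\<forall>g. (\<forall>i\<ge>n. coeff g i = 0) \<longrightarrow> mom (p * g) = 0)" for n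
  proof -
    obtain t where t: "\<And>i. i \<ge> n \<Longrightarrow> coeff t i = 0"
      "\<And>g. (\<And>i. i \<ge> n \<Longrightarrow> coeff g i = 0) \<Longrightarrow> mom ((monom 1 n - t) * g) = 0"
      using orthogonal_projection[of n "monom 1 n"] by blast
    define e where "e = monom 1 n - t"
    have e_n: "coeff e n = 1" and e_gt: "\<And>i. i > n \<Longrightarrow> coeff e i = 0"
      by (auto simp: e_def t)
    have deg: "degree e = n"
      using e_n e_gt by (intro antisym degree_le le_degree) auto
    have pos: "mom (e * e) > 0"
      using e_n by (intro mom_square_pos) auto
    show ?thesis
      using pos deg e_n t(2)
      by (intro exI[of _ "smult (1 / sqrt (mom (e * e))) e"])
        (auto simp: mom_smult real_div_sqrt e_def[symmetric])
  qed
  then obtain p where p: "\<And>n. degree (p n) = n" "\<And>n. coeff (p n) n > 0"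
    "\<And>n. mom (p n * p n) = 1"
    "\<And>n g. (\<And>i. i \<ge> n \<Longrightarrow> coeff g i = 0) \<Longrightarrow> mom (p n * g) = 0"
    by metis
  have lt: "mom (p n * p m) = 0" if "m < n" for m n
    using that p(1)[of m] by (intro p(4)) (auto intro: coeff_eq_0)
  have "mom (p m * p n) = 0" if "m \<noteq> n" for m n
    using lt[of m n] lt[of n m] that by (cases m n rule: linorder_cases) (auto simp: mult.commute)
  then show ?thesis
    using p(1,2,3) unfolding orthonormal_poly_seq_iff by (intro exI[of _ p]) simp
qed

text \<open>
  Orthogonality to \<open>p\<^sub>0, \<dots>, p\<^bsub>n-1\<^esub>\<close> extends to their span, which consists of all polynomials of
  smaller degree: the leading term of \<open>g\<close> can be cancelled against some \<open>p\<^sub>k\<close> with \<open>k < n\<close>.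
\<close>

lemma orthonormal_poly_seq_orthogonal:
  assumes "orthonormal_poly_seq w p" "\<And>i. i \<ge> n \<Longrightarrow> coeff g i = 0"
  shows "mom (p n * g) = 0"
proof -
  have deg: "degree (p m) = m" and lead: "coeff (p m) m > 0"
    and orth: "m \<noteq> k \<Longrightarrow> mom (p m * p k) = 0" for m k
    using assms(1) by (auto simp: orthonormal_poly_seq_iff)
  have "mom (p n * g) = 0" if "k \<le> n" "\<And>i. i \<ge> k \<Longrightarrow> coeff g i = 0" for k
    using that
  proof (induction k arbitrary: g)
    case 0
    then have "g = 0"
      by (intro poly_eqI) simp
    then show ?case
      by simp
  next
    case (Suc k)
    define c where "c = coeff g k / coeff (p k) k"
    have "mom (p n * (g - smult c (p k))) = 0"
    proof (rule Suc.IH)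
      fix i assume "k \<le> i"
      then show "coeff (g - smult c (p k)) i = 0"
        using lead[of k] deg[of k] Suc.prems(2)[of i] coeff_eq_0[of "p k" i]
        by (cases "i = k") (auto simp: c_def)
    qed (use Suc.prems in simp)
    then show ?case
      using orth[of n k] Suc.prems(1) by (simp add: mom_simps)
  qed
  from this[of n] assms(2) show ?thesis
    by simp
qed

text \<open>
  Scaled to equal leading coefficients, the two polynomials of degree \<open>n\<close> differ by some \<open>d\<close> of
  smaller degree, which is orthogonal to both and hence to itself. The factor is a positive
  number whose square is 1.
\<close>

lemma orthonormal_poly_seq_unique:
  assumes "orthonormal_poly_seq w p" "orthonormal_poly_seq w q"
  shows "p = q"
proof
  fix n
  have deg: "degree (p n) = n" "degree (q n) = n"
    and lead: "coeff (p n) n > 0" "coeff (q n) n > 0"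
    and norm: "mom (p n * p n) = 1" "mom (q n * q n) = 1"
    using assms by (auto simp: orthonormal_poly_seq_iff)
  define c where "c = coeff (p n) n / coeff (q n) n"
  define d where "d = p n - smult c (q n)"
  have "c > 0"
    using lead by (simp add: c_def)
  have d: "coeff d i = 0" if "i \<ge> n" for i
    using that lead deg coeff_eq_0[of "p n" i] coeff_eq_0[of "q n" i]
    by (cases "i = n") (auto simp: d_def c_def)
  have "mom (p n * d) = 0" "mom (q n * d) = 0"
    using assms d by (auto intro: orthonormal_poly_seq_orthogonal)
  then have "mom (d * d) = 0"
    by (subst d_def) (simp add: mom_simps)
  then have "d = 0"
    using mom_square_pos[of d] by force
  then have eq: "p n = smult c (q n)"
    by (simp add: d_def)
  have "c * c = 1"
    using norm by (simp add: eq mom_smult)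
  then have "c = 1"
    using \<open>c > 0\<close> by (simp add: square_eq_1_iff)
  then show "p n = q n"
    by (simp add: eq)
qed

lemma orthonormal_poly_seq_orthonormal_poly:
  "orthonormal_poly_seq w (orthonormal_poly w)"
proof -
  obtain p where p: "orthonormal_poly_seq w p"
    using ex_orthonormal_poly_seq by blast
  show ?thesis
    unfolding orthonormal_poly_def
    by (rule theI[where P = "orthonormal_poly_seq w", OF p]) (rule orthonormal_poly_seq_unique[OF _ p])
qed

text \<open>
  For an even weight the polynomials \<open>(-1)\<^sup>n p\<^sub>n(-x)\<close> are orthonormal with positive leading
  coefficients too, so by uniqueness they are the \<open>p\<^sub>n\<close>.
\<close>

lemma orthonormal_poly_odd:
  assumes even_w: "\<And>x. w (- x) = w x" and "odd n"
  shows "poly (orthonormal_poly w n) 0 = 0"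
proof -
  define p where "p = orthonormal_poly w"
  define q where "q m = smult ((- 1) ^ m) (pcompose (p m) [:0, -1:])" for m
  have p: "orthonormal_poly_seq w p"
    unfolding p_def by (rule orthonormal_poly_seq_orthonormal_poly)
  have reflect: "mom (pcompose r [:0, -1:]) = mom r" for r
    using lborel_integral_real_affine[of "-1" "\<lambda>x. w x * poly r x" 0]
    by (simp add: mom_def poly_pcompose even_w)
  have "mom (q m * q k) = (- 1) ^ (m + k) * mom (p m * p k)" for m k
    by (simp add: q_def mom_smult pcompose_mult[symmetric] reflect power_add mult_ac)
  moreover have "degree (q m) = m" for m
    using p by (simp add: q_def degree_pcompose orthonormal_poly_seq_iff)
  moreover have "coeff (q m) m = coeff (p m) m" for m
    using p lead_coeff_comp[of "[:0, -1:]" "p m"]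
    by (simp add: q_def degree_pcompose orthonormal_poly_seq_iff flip: power_mult_distrib)
  ultimately have "orthonormal_poly_seq w q"
    using p by (simp add: orthonormal_poly_seq_iff)
  then have "p = q"
    by (rule orthonormal_poly_seq_unique[OF p])
  then have "poly (p n) 0 = poly (q n) 0"
    by simp
  then show ?thesis
    using \<open>odd n\<close> by (simp add: q_def poly_pcompose p_def)
qed

text \<open>
  This is the off-diagonal coefficient of the three-term recurrence: the part of \<open>x p\<^sub>n\<close> along
  \<open>p\<^bsub>n+1\<^esub>\<close> is the quotient \<open>c\<close> of the leading coefficients.
\<close>

lemma mom_x_orthonormal_poly_Suc:
  "mom (pCons 0 (orthonormal_poly w n) * orthonormal_poly w (Suc n)) \<noteq> 0"
proof -
  define p where "p = orthonormal_poly w"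
  have p: "orthonormal_poly_seq w p"
    unfolding p_def by (rule orthonormal_poly_seq_orthonormal_poly)
  have deg: "degree (p k) = k" and lead: "coeff (p k) k > 0" and norm: "mom (p k * p k) = 1" for k
    using p by (auto simp: orthonormal_poly_seq_iff)
  define c where "c = coeff (p n) n / coeff (p (Suc n)) (Suc n)"
  have "c > 0"
    using lead by (simp add: c_def)
  have "mom (p (Suc n) * (pCons 0 (p n) - smult c (p (Suc n)))) = 0"
  proof (rule orthonormal_poly_seq_orthogonal[OF p])
    fix i assume "Suc n \<le> i"
    then obtain j where j: "i = Suc j" "n \<le> j"
      by (cases i) auto
    show "coeff (pCons 0 (p n) - smult c (p (Suc n))) i = 0"
    proof (cases "j = n")
      case True
      then show ?thesis
        using lead[of "Suc n"] by (simp add: c_def j(1))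
    next
      case False
      then show ?thesis
        using j(2) deg[of n] deg[of "Suc n"] by (simp add: j(1) coeff_eq_0)
    qed
  qed
  then have "mom (pCons 0 (p n) * p (Suc n)) = c"
    using norm[of "Suc n"]
    by (simp add: right_diff_distrib mom_diff mom_smult mult.commute[of "pCons 0 (p n)"]
        del: mult_pCons_left mult_pCons_right)
  then show ?thesis
    using \<open>c > 0\<close> by (simp add: p_def)
qed

end

section \<open>The generalised Hermite weight\<close>

lemma gen_hermite_weight_nonzero:
  "x \<noteq> 0 \<Longrightarrow> gen_hermite_weight \<mu> x = \<bar>x\<bar> powr (2 * \<mu>) * exp (- (x ^ 2))"
  by (simp add: gen_hermite_weight_def)

lemma gen_hermite_weight_minus: "gen_hermite_weight \<mu> (- x) = gen_hermite_weight \<mu> x"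
  by (simp add: gen_hermite_weight_def)

lemma gen_hermite_weight_pos: "x \<noteq> 0 \<Longrightarrow> 0 < gen_hermite_weight \<mu> x"
  by (simp add: gen_hermite_weight_nonzero)

lemma borel_measurable_gen_hermite_weight [measurable]:
  "gen_hermite_weight \<mu> \<in> borel_measurable borel"
  unfolding gen_hermite_weight_def by measurable

text \<open>On each half-line this is the integrand of the Gamma function at \<open>a + 1\<close>.\<close>

lemma integrable_abs_powr_exp:
  fixes a :: real
  assumes "a > -1"
  shows "integrable lborel (\<lambda>x. \<bar>x\<bar> powr a * exp (- \<bar>x\<bar>))"
proof -
  define g where "g x = indicator {0..} x * (x powr a / exp x)" for x :: real
  have meas: "g \<in> borel_measurable lborel"
    unfolding g_def by measurable
  have "(\<lambda>t. t powr a / exp t) integrable_on {0..}"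
    using Gamma_integral_real[of "a + 1"] assms by (auto simp: integrable_on_def)
  then have "(\<lambda>t. t powr a / exp t) absolutely_integrable_on {0..}"
    by (rule nonnegative_absolutely_integrable_1) simp
  then have "integrable lebesgue g"
    by (simp add: set_integrable_def g_def[abs_def])
  then have g: "integrable lborel g"
    using integrable_completion[of g lborel] meas by simp
  have g': "integrable lborel (\<lambda>x. g (- x))"
    using lborel_integrable_real_affine[OF g, of "-1" 0] by simp
  have "(\<lambda>x. g x + g (- x)) = (\<lambda>x. \<bar>x\<bar> powr a * exp (- \<bar>x\<bar>))"
    by (auto simp: g_def indicator_def exp_minus field_simps)
  with Bochner_Integration.integrable_add[OF g g'] show ?thesis
    by simp
qed

text \<open>
  The bound \<open>exp (- x\<^sup>2) \<le> exp (1 - \<bar>x\<bar>)\<close> reduces the moments to Gamma integrals with exponent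
  \<open>2\<mu> + n > -1\<close>.
\<close>

lemma moment_weight_gen_hermite_weight:
  assumes "\<mu> > - 1 / 2"
  shows "moment_weight (gen_hermite_weight \<mu>)"
proof
  show "AE x in lborel. 0 < gen_hermite_weight \<mu> x"
    using AE_lborel_singleton[of 0] by eventually_elim (rule gen_hermite_weight_pos)
next
  fix n :: nat
  have "integrable lborel (\<lambda>x. exp 1 * (\<bar>x\<bar> powr (2 * \<mu> + n) * exp (- \<bar>x\<bar>)))"
    using assms by (intro integrable_mult_right integrable_abs_powr_exp) linarith
  then show "integrable lborel (\<lambda>x. gen_hermite_weight \<mu> x * x ^ n)"
  proof (rule Bochner_Integration.integrable_bound)
    show "AE x in lborel. norm (gen_hermite_weight \<mu> x * x ^ n)
            \<le> norm (exp 1 * (\<bar>x\<bar> powr (2 * \<mu> + n) * exp (- \<bar>x\<bar>)))"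
      using AE_lborel_singleton[of 0]
    proof eventually_elim
      case (elim x)
      have "\<bar>x\<bar> - 1 \<le> x ^ 2"
        using zero_le_power2[of "\<bar>x\<bar> - 1 / 2"] by (simp add: power2_eq_square algebra_simps)
      then have "exp (- (x ^ 2)) \<le> exp 1 * exp (- \<bar>x\<bar>)"
        by (simp flip: exp_add)
      then have "\<bar>x\<bar> powr (2 * \<mu> + n) * exp (- (x ^ 2))
          \<le> \<bar>x\<bar> powr (2 * \<mu> + n) * (exp 1 * exp (- \<bar>x\<bar>))"
        by (intro mult_left_mono) simp_all
      moreover have "norm (gen_hermite_weight \<mu> x * x ^ n) = \<bar>x\<bar> powr (2 * \<mu> + n) * exp (- (x ^ 2))"
        using elim by (simp add: gen_hermite_weight_nonzero abs_mult power_abs powr_add powr_realpow)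
      ultimately show ?case
        by (simp add: mult_ac)
    qed
  qed measurable
qed

text \<open>
  On the half-line containing \<open>x\<close>, whose sign is \<open>s\<close>, the root of the weight is the smooth function
  \<open>exp (\<mu> ln (s y) - y\<^sup>2 / 2)\<close>.
\<close>

lemma has_real_derivative_sqrt_gen_hermite_weight:
  assumes "x \<noteq> 0"
  shows "((\<lambda>x. sqrt (gen_hermite_weight \<mu> x)) has_real_derivative
            sqrt (gen_hermite_weight \<mu> x) * (\<mu> / x - x)) (at x)"
proof -
  define h where "h s y = exp (\<mu> * ln (s * y) - y ^ 2 / 2)" for s y :: real
  have h: "sqrt (gen_hermite_weight \<mu> y) = h s y" if "s * y > 0" "\<bar>s\<bar> = 1" for s y
  proof -
    have "y \<noteq> 0" "\<bar>y\<bar> = s * y"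
      using that by (auto simp: abs_if split: if_splits)
    have "h s y ^ 2 = exp (2 * (\<mu> * ln (s * y) - y ^ 2 / 2))"
      unfolding h_def power2_eq_square by (simp flip: exp_add)
    also have "\<dots> = exp (2 * \<mu> * ln (s * y)) * exp (- (y ^ 2))"
      by (simp add: algebra_simps flip: exp_add)
    also have "\<dots> = gen_hermite_weight \<mu> y"
      using that \<open>y \<noteq> 0\<close> by (simp add: gen_hermite_weight_nonzero \<open>\<bar>y\<bar> = s * y\<close> powr_def)
    finally show ?thesis
      by (intro real_sqrt_unique) (simp_all add: h_def)
  qed
  define s where "s = sgn x"
  have s: "\<bar>s\<bar> = 1" "s * x > 0"
    using assms by (auto simp: s_def sgn_if)
  have "(h s has_real_derivative h s x * (\<mu> / x - x)) (at x)"
    unfolding h_def using s by (auto intro!: derivative_eq_intros simp: field_simps)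
  moreover have "open {y. s * y > 0}"
    by (intro open_Collect_less continuous_intros)
  then have "\<forall>\<^sub>F y in nhds x. sqrt (gen_hermite_weight \<mu> y) = h s y"
    unfolding eventually_nhds using s by (intro exI[of _ "{y. s * y > 0}"]) (auto intro: h)
  ultimately show ?thesis
    using DERIV_cong_ev[of x x] h[OF s(2,1)] by simp
qed

section \<open>Rows of odd index of the differentiation matrix\<close>

text \<open>
  Divisibility of \<open>p\<^sub>m\<close> by \<open>x\<close> removes the pole of the logarithmic derivative \<open>\<mu>/x - x\<close> of the
  root of the weight. The integrand then agrees off the origin with the weight times a
  polynomial, so it is integrable and no principal value occurs.
\<close>

lemma diff_matrix_gen_hermite_weight:
  assumes "\<mu> > - 1 / 2"
  defines "w \<equiv> gen_hermite_weight \<mu>"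
  defines "p \<equiv> orthonormal_poly w"
  assumes r: "p m = pCons 0 r"
  shows "diff_matrix w m n =
    moment_weight.mom w ((pderiv (p m) + smult \<mu> r - pCons 0 (p m)) * p n)"
proof -
  interpret moment_weight w
    unfolding w_def using assms(1) by (rule moment_weight_gen_hermite_weight)
  define q where "q = (pderiv (p m) + smult \<mu> r - pCons 0 (p m)) * p n"
  define f where "f x = deriv (phi w m) x * phi w n x" for x
  have eq: "f x = w x * poly q x" if "x \<noteq> 0" for x
  proof -
    have "(phi w m has_real_derivative
        sqrt (w x) * (\<mu> / x - x) * poly (p m) x + poly (pderiv (p m)) x * sqrt (w x)) (at x)"
      unfolding phi_def[abs_def] p_def w_def
      by (rule DERIV_mult[OF has_real_derivative_sqrt_gen_hermite_weight[OF that] poly_DERIV])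
    then have "deriv (phi w m) x
        = sqrt (w x) * ((\<mu> / x - x) * poly (p m) x + poly (pderiv (p m)) x)"
      by (simp add: DERIV_imp_deriv algebra_simps)
    moreover have "\<mu> / x * poly (p m) x = \<mu> * poly r x"
      using that by (simp add: r)
    ultimately have "f x = sqrt (w x) * sqrt (w x) *
        ((\<mu> * poly r x - x * poly (p m) x + poly (pderiv (p m)) x) * poly (p n) x)"
      by (simp add: f_def phi_def p_def[symmetric] left_diff_distrib del: real_sqrt_mult_self)
    also have "sqrt (w x) * sqrt (w x) = w x"
      using gen_hermite_weight_pos[OF that, of \<mu>] by (simp add: w_def)
    finally show ?thesis
      by (simp add: q_def algebra_simps)
  qed
  have ae: "AE x in lborel. w x * poly q x = f x"
    using AE_lborel_singleton[of 0] by eventually_elim (simp add: eq)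
  have [measurable]: "w \<in> borel_measurable borel"
    unfolding w_def by measurable
  \<comment> \<open>At the origin \<open>deriv\<close> may be an unspecified value, which a single point makes harmless.\<close>
  have "f = (\<lambda>x. if x = 0 then f 0 else w x * poly q x)"
    using eq by auto
  also have "\<dots> \<in> borel_measurable lborel"
    using borel_measurable_integrable[OF integrable_weight_poly[of q]] by measurable
  finally have meas: "f \<in> borel_measurable lborel" .
  have int: "integrable lborel f"
    using integrable_weight_poly meas ae by (rule integrable_cong_AE_imp)
  have "diff_matrix w m n = (LINT x|lborel. f x)"
    using int by (simp add: diff_matrix_def pv_integral_def flip: f_def)
  also have "\<dots> = mom q"
    unfolding mom_def using meas integrable_weight_poly ae
    by (intro integral_cong_AE) (auto simp: eq_commute)
  finally show ?thesis
    by (simp add: q_def)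
qed

text \<open>
  Both \<open>p\<^sub>m'\<close> and \<open>p\<^sub>m / x\<close> have degree less than \<open>n\<close> and contribute nothing; what remains
  is the tridiagonal matrix of multiplication by \<open>x\<close>.
\<close>

lemma diff_matrix_gen_hermite_weight_odd_row:
  assumes "\<mu> > - 1 / 2" "odd m" "m < n"
  shows "diff_matrix (gen_hermite_weight \<mu>) m n = 0 \<longleftrightarrow> n \<noteq> Suc m"
proof -
  define w where "w = gen_hermite_weight \<mu>"
  define p where "p = orthonormal_poly w"
  interpret moment_weight w
    unfolding w_def using assms(1) by (rule moment_weight_gen_hermite_weight)
  have p: "orthonormal_poly_seq w p"
    unfolding p_def by (rule orthonormal_poly_seq_orthonormal_poly)
  have deg: "degree (p m) = m"
    using p by (simp add: orthonormal_poly_seq_iff)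
  have "poly (p m) 0 = 0"
    unfolding p_def using assms(2)
    by (intro orthonormal_poly_odd) (simp_all add: w_def gen_hermite_weight_minus)
  then obtain r where r: "p m = pCons 0 r"
    by (cases "p m") auto
  have high: "coeff (p m) i = 0" if "i > m" for i
    using that deg by (auto intro: coeff_eq_0)
  have "mom (p n * (pderiv (p m) + smult \<mu> r)) = 0"
  proof (rule orthonormal_poly_seq_orthogonal[OF p])
    fix i assume "n \<le> i"
    then show "coeff (pderiv (p m) + smult \<mu> r) i = 0"
      using high[of "Suc i"] assms(3) by (simp add: coeff_pderiv r)
  qed
  then have *: "diff_matrix w m n = - mom (pCons 0 (p m) * p n)"
    using diff_matrix_gen_hermite_weight[OF assms(1), of m r n] r
    by (simp add: w_def[symmetric] p_def[symmetric] left_diff_distrib mom_diff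
        mult.commute[of "p n"] del: mult_pCons_left)
  show ?thesis
  proof (cases "n = Suc m")
    case True
    then show ?thesis
      using * mom_x_orthonormal_poly_Suc[of m]
      by (simp add: w_def[symmetric] p_def[symmetric] del: mult_pCons_left)
  next
    case False
    have "mom (p n * pCons 0 (p m)) = 0"
    proof (rule orthonormal_poly_seq_orthogonal[OF p])
      fix i assume "n \<le> i"
      then show "coeff (pCons 0 (p m)) i = 0"
        using high[of "i - 1"] assms(3) False by (cases i) auto
    qed
    then show ?thesis
      using * False by (simp add: w_def[symmetric] mult.commute)
  qed
qed

theorem mainTheorem12:
  fixes \<mu> :: real
  assumes "\<mu> > - 1 / 2"
  shows "\<not> separable (gen_hermite_weight \<mu>) \<and>
         \<not> symmetrically_separable (gen_hermite_weight \<mu>)"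
proof -
  let ?D = "diff_matrix (gen_hermite_weight \<mu>)"
  have D: "?D 1 2 \<noteq> 0" "?D 3 4 \<noteq> 0" "?D 1 4 = 0"
    using diff_matrix_gen_hermite_weight_odd_row[OF assms, of 1 2]
      diff_matrix_gen_hermite_weight_odd_row[OF assms, of 3 4]
      diff_matrix_gen_hermite_weight_odd_row[OF assms, of 1 4]
    by auto
  show ?thesis
  proof (intro conjI notI)
    assume "separable (gen_hermite_weight \<mu>)"
    then obtain a b :: "nat \<Rightarrow> real" where "\<And>m n. m + 1 \<le> n \<Longrightarrow> ?D m n = - (a n * b m)"
      unfolding separable_def by metis
    from this[of 1 2] this[of 3 4] this[of 1 4] D show False
      by simp
  next
    assume "symmetrically_separable (gen_hermite_weight \<mu>)"
    then obtain a b :: "nat \<Rightarrow> real" where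
      "\<And>m n. odd (m + n) \<Longrightarrow> m + 1 \<le> n \<Longrightarrow> ?D m n = a n * b m"
      unfolding symmetrically_separable_def by metis
    from this[of 1 2] this[of 3 4] this[of 1 4] D show False
      by simp
  qed
qed

end
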